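(* Let $(\mathcal{B},\mu)$ be a strictly positive atomless normalized measure algebra. For $F:[0,1]^2\to[0,1]$ let $$\mathcal{E}(F)=\sup_{a,b\in\mathcal{B}}\left|\mu(a\wedge b)-F(\mu(a),\mu(b))\right|.$$ Then $\inf_F\mathcal{E}(F)=1/4$, where the infimum is over all functions $F:[0,1]^2\to[0,1]$. The infimum is also $1/4$ when $F$ is restricted to t-norms, and $F(x,y)=xy$ attains it.
   Context: A strictly positive atomless normalized measure algebra $(\mathcal{B},\mu)$ is a Dedekind $\sigma$-complete Boolean algebra $\mathcal{B}$ with a countably additive $\mu:\mathcal{B}\to[0,1]$ such that $\mu(1)=1$, $\mu(a)>0$ for every $a\neq 0$, and $\mathcal{B}$ has no atoms. A t-norm is a commutative, associative operation $[0,1]^2\to[0,1]$ that is nondecreasing in each argument and has neutral element $1$. *)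

theory Defs
  imports Complex_Main "HOL-Library.Countable_Complete_Lattices"
begin

definition is_atom :: "'a::boolean_algebra \<Rightarrow> bool" where
  "is_atom a \<longleftrightarrow> a \<noteq> bot \<and> (\<forall>b\<le>a. b = bot \<or> b = a)"

text \<open>The Boolean algebra is the whole type. The sort asks for suprema and infima of all
  countable sets; as a Boolean algebra is bounded, this is Dedekind sigma-completeness.
  The equation \<open>\<mu> bot = 0\<close> is not listed: it is countable additivity for the
  constant sequence \<open>bot\<close>.\<close>

locale atomless_normalized_measure_algebra =
  fixes \<mu> :: "'a::{boolean_algebra, countable_complete_lattice} \<Rightarrow> real"
  assumes range: "\<mu> a \<in> {0..1}"
    and countably_additive:
      "(\<And>i j. i \<noteq> j \<Longrightarrow> inf (A i) (A j) = bot) \<Longrightarrow>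
        (\<lambda>n. \<mu> (A n)) sums \<mu> (SUP n::nat. A n)"
    and normalized: "\<mu> top = 1"
    and strictly_positive: "a \<noteq> bot \<Longrightarrow> \<mu> a > 0"
    and atomless: "\<not> is_atom a"

text \<open>A function on the unit square is represented by a total function on the reals whose
  values outside the square are irrelevant.\<close>

definition unit_square_op :: "(real \<Rightarrow> real \<Rightarrow> real) \<Rightarrow> bool" where
  "unit_square_op F \<longleftrightarrow> (\<forall>x\<in>{0..1}. \<forall>y\<in>{0..1}. F x y \<in> {0..1})"

definition t_norm :: "(real \<Rightarrow> real \<Rightarrow> real) \<Rightarrow> bool" where
  "t_norm T \<longleftrightarrow> unit_square_op T \<and>
    (\<forall>x\<in>{0..1}. \<forall>y\<in>{0..1}. T x y = T y x) \<and>
    (\<forall>x\<in>{0..1}. \<forall>y\<in>{0..1}. \<forall>z\<in>{0..1}. T (T x y) z = T x (T y z)) \<and>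
    (\<forall>y\<in>{0..1}. mono_on {0..1} (\<lambda>x. T x y)) \<and>
    (\<forall>x\<in>{0..1}. mono_on {0..1} (\<lambda>y. T x y)) \<and>
    (\<forall>x\<in>{0..1}. T x 1 = x \<and> T 1 x = x)"

text \<open>The supremum is taken in the reals; when \<open>\<mu>\<close> has values in the unit interval
  and \<open>unit_square_op F\<close> holds, the set is bounded by 1.\<close>

definition approx_error ::
    "('a::boolean_algebra \<Rightarrow> real) \<Rightarrow> (real \<Rightarrow> real \<Rightarrow> real) \<Rightarrow> real" where
  "approx_error \<mu> F = (SUP (a, b) \<in> UNIV. \<bar>\<mu> (inf a b) - F (\<mu> a) (\<mu> b)\<bar>)"

end

(* An atomless measure takes the value 1/2 at some a, and the pairs (a, a) and (a, -a) force
   F (1/2) (1/2) to approximate both 1/2 and 0, so every F has error at least 1/4.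
   For the product, let p, q, r, s be the measures of the four cells cut out by a and b;
   then p - (p + q) * (p + r) = p * s - q * r because p + q + r + s = 1, and each of the two
   products is at most 1/4. *)

theory Submission
  imports Defs
begin

context atomless_normalized_measure_algebra
begin

section \<open>Finite additivity and continuity from below\<close>

lemma measure_bot: "\<mu> bot = 0"
proof -
  have "(\<lambda>n::nat. \<mu> bot) sums \<mu> (SUP n::nat. bot)"
    by (rule countably_additive) simp
  then have "summable (\<lambda>n::nat. \<mu> bot)"
    by (rule sums_summable)
  then show ?thesis
    by (simp add: summable_const_iff)
qed

lemma measure_sup:
  assumes "inf a b = bot"
  shows "\<mu> (sup a b) = \<mu> a + \<mu> b"
proof -
  \<comment> \<open>Padding the pair with \<open>bot\<close> turns countable additivity into finite
    additivity, since \<open>\<mu> bot = 0\<close>.\<close>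
  define A where "A n = (if n = 0 then a else if n = 1 then b else bot)" for n :: nat
  have "(\<lambda>n. \<mu> (A n)) sums \<mu> (SUP n. A n)"
    using assms by (intro countably_additive) (auto simp: A_def inf.commute)
  moreover have "(\<lambda>n. \<mu> (A n)) sums (\<Sum>n\<in>{0, 1}. \<mu> (A n))"
    by (rule sums_finite) (auto simp: A_def measure_bot)
  moreover have "(SUP n. A n) = sup a b"
  proof (rule antisym)
    show "(SUP n. A n) \<le> sup a b"
      by (rule ccSUP_least) (auto simp: A_def)
    have "A 0 \<le> (SUP n. A n)" "A 1 \<le> (SUP n. A n)"
      by (rule ccSUP_upper; simp)+
    then show "sup a b \<le> (SUP n. A n)"
      by (simp add: A_def)
  qed
  ultimately show ?thesis
    using sums_unique2 by (fastforce simp: A_def)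
qed

lemma measure_split: "\<mu> a = \<mu> (inf a b) + \<mu> (inf a (- b))"
proof -
  have "sup (inf a b) (inf a (- b)) = a"
    by (simp flip: inf_sup_distrib1)
  moreover have "inf (inf a b) (inf a (- b)) = bot"
    by (simp add: inf_left_commute inf_assoc)
  ultimately show ?thesis
    using measure_sup by metis
qed

lemma measure_diff: "a \<le> b \<Longrightarrow> \<mu> (inf b (- a)) = \<mu> b - \<mu> a"
  using measure_split[of b a] by (simp add: inf.absorb2)

lemma measure_mono: "a \<le> b \<Longrightarrow> \<mu> a \<le> \<mu> b"
  using measure_diff[of a b] range[of "inf b (- a)"] by simp

text \<open>The increments \<open>D n\<close> of the sequence are pairwise disjoint and have the
  same supremum as \<open>A\<close>, and their measures telescope, so countable additivity of
  \<open>D\<close> is the required limit.\<close>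

lemma measure_incseq_tendsto:
  assumes "incseq A"
  shows "(\<lambda>n. \<mu> (A n)) \<longlonglongrightarrow> \<mu> (SUP n. A n)"
proof -
  define D where "D n = (case n of 0 \<Rightarrow> A 0 | Suc m \<Rightarrow> inf (A (Suc m)) (- A m))" for n
  have D_le: "D n \<le> A n" for n
    by (simp add: D_def split: nat.split)
  have disj_less: "inf (D i) (D j) = bot" if "i < j" for i j
  proof -
    \<comment> \<open>\<open>A m\<close> separates the two increments: \<open>D i\<close> lies below
      it, and \<open>D j\<close> has had it removed.\<close>
    obtain m where m: "j = Suc m" "i \<le> m"
      using \<open>i < j\<close> less_imp_Suc_add[of i j] le_add1 by metis
    have "D i \<le> A m"
      using D_le[of i] incseqD[OF assms m(2)] by simp
    moreover have "D j \<le> - A m"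
      by (simp add: D_def m)
    ultimately have "inf (D i) (D j) \<le> inf (A m) (- A m)"
      by (rule inf_mono)
    then show ?thesis
      by (simp add: bot_unique)
  qed
  have "(\<lambda>n. \<mu> (D n)) sums \<mu> (SUP n. D n)"
    by (rule countably_additive) (metis disj_less inf.commute linorder_neqE_nat)
  \<comment> \<open>Partial sums that include the index \<open>n\<close> telescope to
    \<open>\<mu> (A n)\<close> without a shift.\<close>
  then have "(\<lambda>n. \<Sum>i\<le>n. \<mu> (D i)) \<longlonglongrightarrow> \<mu> (SUP n. D n)"
    by (simp add: sums_def_le)
  moreover have "(\<Sum>i\<le>n. \<mu> (D i)) = \<mu> (A n)" for n
    using measure_diff[OF incseq_SucD[OF assms]] by (induction n) (simp_all add: D_def)
  moreover have "(SUP n. D n) = (SUP n. A n)"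
  proof (rule antisym)
    show "(SUP n. D n) \<le> (SUP n. A n)"
      by (rule ccSUP_mono) (use D_le in auto)
    have D_upper: "D n \<le> (SUP n. D n)" for n
      by (rule ccSUP_upper) simp_all
    have "A n \<le> (SUP n. D n)" for n
    proof (induction n)
      case 0
      show ?case
        using D_upper[of 0] by (simp add: D_def)
    next
      case (Suc n)
      have "A (Suc n) \<le> sup (A n) (D (Suc n))"
        by (simp add: D_def sup_inf_distrib1)
      also have "\<dots> \<le> (SUP n. D n)"
        using Suc D_upper by simp
      finally show ?case .
    qed
    then show "(SUP n. A n) \<le> (SUP n. D n)"
      by (intro ccSUP_least) auto
  qed
  ultimately show ?thesis
    by simp
qed

section \<open>Every value in the unit interval is attained\<close>

lemma exists_half_part:
  assumes "a \<noteq> bot"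
  shows "\<exists>b\<le>a. b \<noteq> bot \<and> \<mu> b \<le> \<mu> a / 2"
proof -
  obtain c where c: "c \<le> a" "c \<noteq> bot" "c \<noteq> a"
    using atomless[of a] assms by (auto simp: is_atom_def)
  have "inf a (- c) \<noteq> bot"
    using c by (metis double_compl inf_shunt antisym)
  moreover have "\<mu> (inf a (- c)) = \<mu> a - \<mu> c"
    using c(1) by (rule measure_diff)
  \<comment> \<open>The measures of \<open>c\<close> and \<open>inf a (- c)\<close> add up to
    \<open>\<mu> a\<close>, so one of them is at most half of it.\<close>
  ultimately show ?thesis
    using c by (cases "\<mu> c \<le> \<mu> a / 2") (force intro: exI[of _ c], auto intro!: exI[of _ "inf a (- c)"])
qed

text \<open>Repeated halving pushes the measure below any positive bound; the powers of 1/2 start at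
  1 because \<open>\<mu> a \<le> 1\<close>.\<close>

lemma exists_small_part:
  assumes "a \<noteq> bot" and "0 < e"
  shows "\<exists>b\<le>a. b \<noteq> bot \<and> \<mu> b < e"
proof -
  have halving: "\<exists>b\<le>a. b \<noteq> bot \<and> \<mu> b \<le> (1/2) ^ n" for n
  proof (induction n)
    case 0
    show ?case
      using assms(1) range[of a] by auto
  next
    case (Suc n)
    then obtain b where b: "b \<le> a" "b \<noteq> bot" "\<mu> b \<le> (1/2) ^ n"
      by blast
    obtain c where "c \<le> b" "c \<noteq> bot" "\<mu> c \<le> \<mu> b / 2"
      using exists_half_part[OF b(2)] by blast
    with b show ?case
      by (intro exI[of _ c]) auto
  qed
  obtain n where "(1/2) ^ n < e"
    using real_arch_pow_inv[OF assms(2), of "1/2"] by auto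
  then show ?thesis
    using halving[of n] by force
qed

text \<open>A greedy exhaustion replaces a maximality argument. An increasing sequence of elements
  of measure at most \<open>t\<close> is built, each nearly as large as any such element above its
  predecessor. If its supremum fell short of \<open>t\<close>, a small part of the complement could
  still be added, against the greedy choice.\<close>

lemma exists_measure_eq:
  assumes "0 \<le> t" and "t \<le> 1"
  shows "\<exists>a. \<mu> a = t"
proof -
  \<comment> \<open>The slack \<open>inverse (Suc n)\<close> spares attaining the supremum of the
    admissible measures, yet tends to 0 along the sequence.\<close>
  have step: "\<exists>y. \<mu> y \<le> t \<and> x \<le> y \<and> (\<forall>c\<ge>x. \<mu> c \<le> t \<longrightarrow> \<mu> c < \<mu> y + inverse (Suc n))"
    if "\<mu> x \<le> t" for x n
  proof -
    let ?S = "\<mu> ` {c. x \<le> c \<and> \<mu> c \<le> t}"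
    have "?S \<noteq> {}"
      using that by auto
    moreover have "Sup ?S - inverse (Suc n) < Sup ?S"
      by simp
    ultimately have "\<exists>z\<in>?S. Sup ?S - inverse (Suc n) < z"
      by (rule less_cSupD)
    then obtain y where y: "x \<le> y" "\<mu> y \<le> t" "Sup ?S - inverse (Suc n) < \<mu> y"
      by blast
    have "\<mu> c \<le> Sup ?S" if "x \<le> c" "\<mu> c \<le> t" for c
      by (rule cSup_upper) (use that in \<open>auto intro!: bdd_aboveI[of _ t]\<close>)
    with y show ?thesis
      by (intro exI[of _ y]) force
  qed
  have "\<exists>A. \<forall>n. \<mu> (A n) \<le> t \<and> (A n \<le> A (Suc n) \<and>
      (\<forall>c\<ge>A n. \<mu> c \<le> t \<longrightarrow> \<mu> c < \<mu> (A (Suc n)) + inverse (Suc n)))"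
  proof (rule dependent_nat_choice)
    show "\<exists>x. \<mu> x \<le> t"
      using assms(1) measure_bot by (intro exI[of _ bot]) simp
  qed (rule step)
  then obtain A where A: "\<And>n. \<mu> (A n) \<le> t" "\<And>n. A n \<le> A (Suc n)"
    and greedy: "\<And>n c. A n \<le> c \<Longrightarrow> \<mu> c \<le> t \<Longrightarrow> \<mu> c < \<mu> (A (Suc n)) + inverse (Suc n)"
    by blast
  define a where "a = (SUP n. A n)"
  have upper: "A n \<le> a" for n
    unfolding a_def by (rule ccSUP_upper) simp_all
  have "(\<lambda>n. \<mu> (A n)) \<longlonglongrightarrow> \<mu> a"
    unfolding a_def by (rule measure_incseq_tendsto) (use A(2) in \<open>simp add: incseq_SucI\<close>)
  then have le: "\<mu> a \<le> t"
    by (rule LIMSEQ_le_const2) (use A(1) in auto)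
  have "\<not> \<mu> a < t"
  proof
    assume less: "\<mu> a < t"
    then have "- a \<noteq> bot"
      using assms(2) normalized by (metis compl_bot_eq double_compl not_le)
    then obtain b where b: "b \<le> - a" "b \<noteq> bot" "\<mu> b < t - \<mu> a"
      using exists_small_part[of "- a" "t - \<mu> a"] less by auto
    have "inf a b = bot"
      using b(1) by (metis inf.commute inf_shunt)
    then have ab: "\<mu> (sup a b) = \<mu> a + \<mu> b"
      by (rule measure_sup)
    \<comment> \<open>Once the slack is below \<open>\<mu> b\<close>, the competitor
      \<open>sup a b\<close> at stage \<open>n\<close> is too large: its measure would be less than
      \<open>\<mu> (A (Suc n)) + \<mu> b\<close>, hence less than
      \<open>\<mu> a + \<mu> b\<close>.\<close>
    obtain n where n: "inverse (real (Suc n)) < \<mu> b"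
      using reals_Archimedean[OF strictly_positive[OF b(2)]] by blast
    have "\<mu> (sup a b) < \<mu> (A (Suc n)) + inverse (Suc n)"
      by (rule greedy) (use upper[of n] b(3) ab in \<open>auto intro: le_supI1\<close>)
    with ab n measure_mono[OF upper[of "Suc n"]] show False
      by simp
  qed
  with le have "\<mu> a = t"
    by simp
  then show ?thesis ..
qed

section \<open>Upper and lower error bounds\<close>

lemma abs_measure_inf_diff_mult_le: "\<bar>\<mu> (inf a b) - \<mu> a * \<mu> b\<bar> \<le> 1/4"
proof -
  define p q r s where "p = \<mu> (inf a b)" and "q = \<mu> (inf a (- b))"
    and "r = \<mu> (inf (- a) b)" and "s = \<mu> (inf (- a) (- b))"
  have a: "\<mu> a = p + q"
    unfolding p_def q_def by (rule measure_split)
  have b: "\<mu> b = p + r"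
    using measure_split[of b a] by (simp add: p_def r_def inf.commute)
  have "\<mu> (- a) = r + s"
    unfolding r_def s_def by (rule measure_split)
  moreover have "\<mu> top = \<mu> a + \<mu> (- a)"
    using measure_split[of top a] by simp
  ultimately have total: "p + q + r + s = 1"
    using a normalized by simp
  have nonneg: "0 \<le> p" "0 \<le> q" "0 \<le> r" "0 \<le> s"
    using range by (auto simp: p_def q_def r_def s_def)
  have quarter: "x * y \<le> 1/4" if "0 \<le> x" "0 \<le> y" "x + y \<le> 1" for x y :: real
  proof -
    have "(x + y)\<^sup>2 \<le> 1"
      using that by (simp add: power_le_one)
    moreover have "4 * (x * y) = (x + y)\<^sup>2 - (x - y)\<^sup>2"
      by algebra
    \<comment> \<open>Arithmetic-geometric mean inequality: the square of \<open>x - y\<close> is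
      nonnegative.\<close>
    ultimately show ?thesis
      using zero_le_power2[of "x - y"] by linarith
  qed
  have "p - (p + q) * (p + r) = p * s - q * r"
    using total by algebra
  moreover have "0 \<le> p * s" "0 \<le> q * r"
    using nonneg by simp_all
  moreover have "p * s \<le> 1/4" "q * r \<le> 1/4"
    by (rule quarter; use nonneg total in linarith)+
  \<comment> \<open>Two numbers between 0 and 1/4 differ by at most 1/4.\<close>
  ultimately show ?thesis
    unfolding a b p_def[symmetric] by linarith
qed

text \<open>A real supremum dominates its set only when the set is bounded above; here all values
  lie in the unit interval, so 1 is a bound.\<close>

lemma abs_diff_le_approx_error:
  assumes "unit_square_op F"
  shows "\<bar>\<mu> (inf a b) - F (\<mu> a) (\<mu> b)\<bar> \<le> approx_error \<mu> F"
proof -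
  have "\<bar>\<mu> (inf a b) - F (\<mu> a) (\<mu> b)\<bar> \<le> 1" for a b
  proof -
    have "F (\<mu> a) (\<mu> b) \<in> {0..1}"
      using assms range by (simp add: unit_square_op_def)
    then show ?thesis
      using range[of "inf a b"] by auto
  qed
  then have "bdd_above (range (\<lambda>(a, b). \<bar>\<mu> (inf a b) - F (\<mu> a) (\<mu> b)\<bar>))"
    by (intro bdd_aboveI[of _ 1]) auto
  from cSUP_upper[OF UNIV_I this, of "(a, b)"] show ?thesis
    by (simp add: approx_error_def)
qed

lemma quarter_le_approx_error:
  assumes "unit_square_op F"
  shows "1/4 \<le> approx_error \<mu> F"
proof -
  obtain a where a: "\<mu> a = 1/2"
    using exists_measure_eq[of "1/2"] by auto
  then have compl: "\<mu> (- a) = 1/2"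
    using measure_split[of top a] normalized by simp
  have "\<bar>1/2 - F (1/2) (1/2)\<bar> \<le> approx_error \<mu> F" "\<bar>F (1/2) (1/2)\<bar> \<le> approx_error \<mu> F"
    using abs_diff_le_approx_error[OF assms, of a a]
      abs_diff_le_approx_error[OF assms, of a "- a"]
    unfolding a by (simp_all add: a compl measure_bot)
  \<comment> \<open>The distances from \<open>F (1/2) (1/2)\<close> to 1/2 and to 0 add up to at
    least 1/2, so the larger is at least 1/4.\<close>
  then show ?thesis
    by linarith
qed

end

lemma t_norm_mult: "t_norm (\<lambda>x y. x * y)"
  by (auto simp: t_norm_def unit_square_op_def mult.commute mult.assoc mult_le_one
      intro!: mono_onI mult_left_mono mult_right_mono)

theorem theorem4:
  fixes \<mu> :: "'a::{boolean_algebra, countable_complete_lattice} \<Rightarrow> real"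
  assumes "atomless_normalized_measure_algebra \<mu>"
  shows "(INF F \<in> {F. unit_square_op F}. approx_error \<mu> F) = 1/4 \<and>
    (INF F \<in> {F. t_norm F}. approx_error \<mu> F) = 1/4 \<and>
    t_norm (\<lambda>x y. x * y) \<and>
    approx_error \<mu> (\<lambda>x y. x * y) = 1/4"
proof -
  interpret atomless_normalized_measure_algebra \<mu>
    by (rule assms)
  have unit: "unit_square_op F" if "t_norm F" for F
    using that by (simp add: t_norm_def)
  have mult: "approx_error \<mu> (\<lambda>x y. x * y) = 1/4"
  proof (rule antisym)
    show "approx_error \<mu> (\<lambda>x y. x * y) \<le> 1/4"
      unfolding approx_error_def
      by (rule cSUP_least) (use abs_measure_inf_diff_mult_le in auto)
    show "1/4 \<le> approx_error \<mu> (\<lambda>x y. x * y)"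
      by (intro quarter_le_approx_error unit t_norm_mult)
  qed
  \<comment> \<open>One argument serves both infima: in any class of operations on the unit square
    that contains the product, the product attains the general lower bound.\<close>
  have "(INF F \<in> S. approx_error \<mu> F) = 1/4"
    if "(\<lambda>x y. x * y) \<in> S" "S \<subseteq> {F. unit_square_op F}" for S
  proof (rule cInf_eq_minimum)
    show "1/4 \<in> approx_error \<mu> ` S"
      using that(1) mult by force
    show "1/4 \<le> x" if "x \<in> approx_error \<mu> ` S" for x
      using that \<open>S \<subseteq> _\<close> quarter_le_approx_error by auto
  qed
  then show ?thesis
    using mult t_norm_mult unit by auto
qed

end
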